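(* Let $p\ge2$ and let $\xi=(\xi(1),\dots,\xi(d))$ be a random vector. A. If the coordinates $\xi(1),\dots,\xi(d)$ are centered martingale differences (relative to some filtration), then $$\|\xi\|_{L(p)^{(d)}}\le K_M(p)\max_i|\xi(i)|_p .$$ B. If the coordinates $\xi(1),\dots,\xi(d)$ are centered independent random variables, then $$\|\xi\|_{L(p)^{(d)}}\le K_I(p)\max_i|\xi(i)|_p .$$
   Context: $|\eta|_p=(\mathbf{E}|\eta|^p)^{1/p}$. The norm is $\|\xi\|_{L(p)^{(d)}}=\sup_{b\in\mathbb{R}^d,\,|b|_2\le1}|(\xi,b)|_p$. A sequence $\{\theta(i)\}$ is a sequence of centered martingale differences relative to a filtration $\{F(i)\}$ ($F(0)$ trivial, $F(i)\subset F(i+1)$) if $\theta(i)$ is $F(i)$-measurable and $\mathbf{E}[\theta(i)\mid F(k)]=0$ for all $k=0,1,\dots,i-1$. $K_M(p)$ is the optimal (smallest) constant such that, for all sequences of centered martingale differences $\{\theta(i)\}$, $$\sup_n\ \sup_{b\in\mathbb{R}^n,\ \sum b(i)^2\le1}\Big|\sum_{i=1}^n b(i)\theta(i)\Big|_p\le K_M(p)\sup_i|\theta(i)|_p .$$ $K_I(p)$ is the optimal constant in the same inequality over all sequences of centered independent random variables. It is known that $K_M(p)\le p\sqrt2$ and $K_I(p)\le0.87\,p/\log p$ for $p\ge2$. *)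

theory Defs
  imports "HOL-Probability.Probability"
begin

text \<open>
  All norms and constants take values in \<^typ>\<open>ennreal\<close>: nothing is assumed about the existence of
  \<open>p\<close>-th moments, and a supremum or an infimum never falls back on an unspecified real number.
\<close>

definition Lp_norm :: "'a measure \<Rightarrow> real \<Rightarrow> ('a \<Rightarrow> real) \<Rightarrow> ennreal" where
  "Lp_norm M p \<eta> =
    (let m = (\<integral>\<^sup>+ \<omega>. ennreal (\<bar>\<eta> \<omega>\<bar> powr p) \<partial>M)
     in if m = \<infinity> then \<infinity> else ennreal (enn2real m powr (1 / p)))"

text \<open>
  The random vector \<open>(\<xi>(1), \<dots>, \<xi>(d))\<close> is encoded as a function on indices; only the values at
  \<open>1, \<dots>, d\<close> are used, and likewise for \<open>b\<close>.
\<close>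

definition Lpd_norm :: "'a measure \<Rightarrow> real \<Rightarrow> nat \<Rightarrow> (nat \<Rightarrow> 'a \<Rightarrow> real) \<Rightarrow> ennreal" where
  "Lpd_norm M p d \<xi> =
    (SUP b\<in>{b :: nat \<Rightarrow> real. L2_set b {1..d} \<le> 1}. Lp_norm M p (\<lambda>\<omega>. \<Sum>i=1..d. \<xi> i \<omega> * b i))"

text \<open>
  The index set \<open>I\<close> is \<open>{1..}\<close> for a sequence and \<open>{1..d}\<close> for a vector.  In the latter case \<open>F\<close> is
  still indexed by all naturals, which is no restriction: a filtration \<open>F(0), \<dots>, F(d)\<close> can be
  continued by \<open>F(d)\<close>.  Integrability is explicit because \<^const>\<open>real_cond_exp\<close> is meaningful for
  integrable functions only.
\<close>

definition centered_martingale_differences ::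
    "'a measure \<Rightarrow> (nat \<Rightarrow> 'a measure) \<Rightarrow> nat set \<Rightarrow> (nat \<Rightarrow> 'a \<Rightarrow> real) \<Rightarrow> bool" where
  "centered_martingale_differences M F I \<theta> \<longleftrightarrow>
    filtration (space M) F \<and> (\<forall>i. subalgebra M (F i)) \<and> sets (F 0) = {{}, space M} \<and>
    (\<forall>i\<in>I. integrable M (\<theta> i) \<and> \<theta> i \<in> borel_measurable (F i) \<and>
      (\<forall>k<i. AE \<omega> in M. real_cond_exp M (F k) (\<theta> i) \<omega> = 0))"

definition centered_independent ::
    "'a measure \<Rightarrow> nat set \<Rightarrow> (nat \<Rightarrow> 'a \<Rightarrow> real) \<Rightarrow> bool" where
  "centered_independent M I \<theta> \<longleftrightarrow>
    prob_space.indep_vars M (\<lambda>_. borel) \<theta> I \<and>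
    (\<forall>i\<in>I. integrable M (\<theta> i) \<and> integral\<^sup>L M (\<theta> i) = 0)"

definition norm_inequality ::
    "'a measure \<Rightarrow> real \<Rightarrow> (nat \<Rightarrow> 'a \<Rightarrow> real) \<Rightarrow> ennreal \<Rightarrow> bool" where
  "norm_inequality M p \<theta> C \<longleftrightarrow>
    (SUP n\<in>{1..}. SUP b\<in>{b :: nat \<Rightarrow> real. (\<Sum>i=1..n. (b i)\<^sup>2) \<le> 1}.
       Lp_norm M p (\<lambda>\<omega>. \<Sum>i=1..n. b i * \<theta> i \<omega>))
    \<le> C * (SUP i\<in>{1..}. Lp_norm M p (\<theta> i))"

text \<open>
  A definition cannot quantify over types, so the two optimal constants range over all probability
  spaces whose points are real sequences, with arbitrary \<open>\<sigma>\<close>-algebra, measure and filtration.  This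
  loses no generality: both classes of sequences and both sides of the inequality depend on the
  joint law only (pass to the natural filtration), and that law lives on \<^typ>\<open>nat \<Rightarrow> real\<close>.
\<close>

definition K_M :: "real \<Rightarrow> ennreal" where
  "K_M p = Inf {C. \<forall>(M :: (nat \<Rightarrow> real) measure) F \<theta>.
     prob_space M \<longrightarrow> centered_martingale_differences M F {1..} \<theta> \<longrightarrow> norm_inequality M p \<theta> C}"

definition K_I :: "real \<Rightarrow> ennreal" where
  "K_I p = Inf {C. \<forall>(M :: (nat \<Rightarrow> real) measure) \<theta>.
     prob_space M \<longrightarrow> centered_independent M {1..} \<theta> \<longrightarrow> norm_inequality M p \<theta> C}"

end

theory Submission
  imports Defs
begin

text \<open>
  Every pair (space, vector) is replaced by the law of the vector, continued by zeros, on the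
  space of real sequences, where the defining inequality of the optimal constant applies with
  \<open>n = d\<close>.  The filtration is transported as the family of events whose preimages lie in \<open>F k\<close>.
  Passing to the infimum over the constants could only fail for an infinite right-hand maximum and
  a vanishing infimum; a fair coin shows that every admissible constant is at least \<open>1\<close>.
\<close>

section \<open>The \<open>L\<^sup>p\<close> norm\<close>

lemma Lp_norm_distr:
  assumes [measurable]: "X \<in> measurable M N" "f \<in> borel_measurable N"
  shows "Lp_norm (distr M N X) p f = Lp_norm M p (\<lambda>\<omega>. f (X \<omega>))"
  unfolding Lp_norm_def by (subst nn_integral_distr) auto

lemma Lp_norm_cong:
  assumes "\<And>\<omega>. \<omega> \<in> space M \<Longrightarrow> f \<omega> = g \<omega>"
  shows "Lp_norm M p f = Lp_norm M p g"
proof -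
  have "(\<integral>\<^sup>+ \<omega>. ennreal (\<bar>f \<omega>\<bar> powr p) \<partial>M) = (\<integral>\<^sup>+ \<omega>. ennreal (\<bar>g \<omega>\<bar> powr p) \<partial>M)"
    by (rule nn_integral_cong) (simp add: assms)
  then show ?thesis unfolding Lp_norm_def by simp
qed

text \<open>\<open>0 powr p\<close> is 0 and every other base has a positive power, so the integrand
  vanishes exactly where \<open>f\<close> does; an infinite integral gives the norm
  \<open>\<infinity>\<close>, hence not 0.\<close>

lemma Lp_norm_eq_0_iff:
  assumes [measurable]: "f \<in> borel_measurable M"
  shows "Lp_norm M p f = 0 \<longleftrightarrow> (AE \<omega> in M. f \<omega> = 0)"
proof -
  have "Lp_norm M p f = 0 \<longleftrightarrow> (\<integral>\<^sup>+ \<omega>. ennreal (\<bar>f \<omega>\<bar> powr p) \<partial>M) = 0"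
    unfolding Lp_norm_def Let_def by (auto simp: enn2real_eq_0_iff)
  also have "\<dots> \<longleftrightarrow> (AE \<omega> in M. f \<omega> = 0)"
    by (subst nn_integral_0_iff_AE) (auto simp: ennreal_eq_0_iff not_less)
  finally show ?thesis .
qed

lemma (in prob_space) Lp_norm_abs_1:
  assumes "\<And>\<omega>. \<bar>f \<omega>\<bar> = 1"
  shows "Lp_norm M p f = 1"
  unfolding Lp_norm_def by (simp add: assms emeasure_space_1)

text \<open>Outside a finite union of null sets all coordinates vanish together, and then so does
  every linear combination. This settles the degenerate case of a zero maximum on the right-hand
  side.\<close>

lemma Lpd_norm_eq_0:
  assumes meas: "\<And>i. i \<in> {1..d} \<Longrightarrow> \<xi> i \<in> borel_measurable M"
    and zero: "\<And>i. i \<in> {1..d} \<Longrightarrow> Lp_norm M p (\<xi> i) = 0"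
  shows "Lpd_norm M p d \<xi> = 0"
proof -
  have "AE \<omega> in M. \<forall>i\<in>{1..d}. \<xi> i \<omega> = 0"
    using zero by (subst AE_ball_countable) (auto simp: Lp_norm_eq_0_iff meas)
  then have "AE \<omega> in M. (\<Sum>i=1..d. \<xi> i \<omega> * b i) = 0" for b
    by eventually_elim simp
  then have "Lp_norm M p (\<lambda>\<omega>. \<Sum>i=1..d. \<xi> i \<omega> * b i) = 0" for b
    using meas by (subst Lp_norm_eq_0_iff) (auto intro!: borel_measurable_sum borel_measurable_times)
  moreover have "{b :: nat \<Rightarrow> real. L2_set b {1..d} \<le> 1} \<noteq> {}"
    by (auto intro!: exI[of _ "\<lambda>_. 0"] simp: L2_set_def)
  ultimately show ?thesis unfolding Lpd_norm_def by simp
qed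

text \<open>The test vector is the constant 1, a unit vector in dimension one.\<close>

lemma Lp_norm_le_Lpd_norm_1: "Lp_norm M p (\<xi> 1) \<le> Lpd_norm M p 1 \<xi>"
  unfolding Lpd_norm_def by (rule SUP_upper2[of "\<lambda>_. 1"]) (auto simp: L2_set_def)

text \<open>For \<open>x\<close> finite and nonzero, divide by \<open>x\<close>. For
  \<open>x = \<infinity>\<close> the convention \<open>0 * \<infinity> = 0\<close> could destroy the
  bound; the lower bound 1 on \<open>S\<close> keeps \<open>Inf S\<close> away from 0, so the
  right-hand side is infinite.\<close>

lemma le_Inf_mult_ennreal:
  fixes L x :: ennreal
  assumes le: "\<And>C. C \<in> S \<Longrightarrow> L \<le> C * x"
    and ge1: "\<And>C. C \<in> S \<Longrightarrow> 1 \<le> C"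
    and zero: "x = 0 \<Longrightarrow> L = 0"
  shows "L \<le> Inf S * x"
proof -
  consider "x = 0" | "x = \<infinity>" | "x \<noteq> 0" "x < \<infinity>"
    by (metis infinity_ennreal_def top.not_eq_extremum)
  then show ?thesis
  proof cases
    case 1
    then show ?thesis using zero by simp
  next
    case 2
    have "1 \<le> Inf S" using ge1 by (rule Inf_greatest)
    then have "Inf S \<noteq> 0" by auto
    then show ?thesis using 2 by (simp add: ennreal_mult_top)
  next
    case 3
    have "L / x \<le> Inf S"
      using 3 le by (intro Inf_greatest) (auto simp: divide_le_posI_ennreal mult.commute zero_less_iff_neq_zero)
    then have "L / x * x \<le> Inf S * x" by (rule mult_right_mono) simp
    moreover have "L / x * x = L"
      using 3 by (simp add: ennreal_divide_times)
    ultimately show ?thesis by simp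
  qed
qed

section \<open>The law of a vector on the space of sequences\<close>

text \<open>The optimal constants are defined through infinite sequences. Zeros preserve centering
  and independence, respectively the martingale property, and add nothing to either side of the
  inequality.\<close>

definition zero_ext :: "nat \<Rightarrow> (nat \<Rightarrow> 'a \<Rightarrow> real) \<Rightarrow> 'a \<Rightarrow> nat \<Rightarrow> real" where
  "zero_ext d \<xi> \<omega> = (\<lambda>i. if i \<in> {1..d} then \<xi> i \<omega> else 0)"

text \<open>The points are real sequences because \<open>K_M\<close> and \<open>K_I\<close> range
  over probability spaces on that type.\<close>

definition seq_law :: "'a measure \<Rightarrow> nat \<Rightarrow> (nat \<Rightarrow> 'a \<Rightarrow> real) \<Rightarrow> (nat \<Rightarrow> real) measure" where
  "seq_law M d \<xi> = distr M (PiM UNIV (\<lambda>_. borel)) (zero_ext d \<xi>)"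

lemma zero_ext_coordinate:
  "(\<lambda>\<omega>. zero_ext d \<xi> \<omega> i) = (if i \<in> {1..d} then \<xi> i else (\<lambda>_. 0))"
  by (auto simp: zero_ext_def)

locale random_vector = prob_space M for M :: "'a measure" +
  fixes d :: nat and \<xi> :: "nat \<Rightarrow> 'a \<Rightarrow> real"
  assumes random: "\<And>i. i \<in> {1..d} \<Longrightarrow> \<xi> i \<in> borel_measurable M"
begin

lemma measurable_zero_ext [measurable]: "zero_ext d \<xi> \<in> measurable M (PiM UNIV (\<lambda>_. borel))"
proof (rule measurable_PiM_single')
  show "(\<lambda>\<omega>. zero_ext d \<xi> \<omega> i) \<in> borel_measurable M" for i
    using random[of i] by (simp add: zero_ext_coordinate)
qed simp

lemma space_seq_law [simp]: "space (seq_law M d \<xi>) = UNIV"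
  by (auto simp: seq_law_def space_PiM)

lemma sets_seq_law [simp, measurable_cong]: "sets (seq_law M d \<xi>) = sets (PiM UNIV (\<lambda>_. borel))"
  by (simp add: seq_law_def)

lemma prob_space_seq_law: "prob_space (seq_law M d \<xi>)"
  unfolding seq_law_def by (rule prob_space_distr) measurable

lemma measurable_coordinate [measurable]: "(\<lambda>x. x i) \<in> borel_measurable (PiM UNIV (\<lambda>_. borel))"
  by (rule measurable_component_singleton) simp

lemma measure_seq_law:
  "A \<in> sets (PiM UNIV (\<lambda>_. borel)) \<Longrightarrow> measure (seq_law M d \<xi>) A = prob (zero_ext d \<xi> -` A \<inter> space M)"
  unfolding seq_law_def by (rule measure_distr) auto

lemma Lp_norm_coordinate:
  "Lp_norm (seq_law M d \<xi>) p (\<lambda>x. x i) = (if i \<in> {1..d} then Lp_norm M p (\<xi> i) else 0)"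
proof -
  have "Lp_norm (seq_law M d \<xi>) p (\<lambda>x. x i) = Lp_norm M p (\<lambda>\<omega>. zero_ext d \<xi> \<omega> i)"
    unfolding seq_law_def by (rule Lp_norm_distr) measurable
  also have "\<dots> = (if i \<in> {1..d} then Lp_norm M p (\<xi> i) else 0)"
    by (simp add: zero_ext_coordinate Lp_norm_eq_0_iff)
  finally show ?thesis .
qed

lemma Lpd_norm_le_of_norm_inequality:
  assumes ineq: "norm_inequality (seq_law M d \<xi>) p (\<lambda>i x. x i) C" and d: "d \<ge> 1"
  shows "Lpd_norm M p d \<xi> \<le> C * Max ((\<lambda>i. Lp_norm M p (\<xi> i)) ` {1..d})"
proof -
  let ?N = "seq_law M d \<xi>"
  have "Lpd_norm M p d \<xi> \<le> C * (SUP i\<in>{1..}. Lp_norm ?N p (\<lambda>x. x i))"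
    unfolding Lpd_norm_def
  proof (rule SUP_least)
    fix b :: "nat \<Rightarrow> real" assume "b \<in> {b. L2_set b {1..d} \<le> 1}"
    then have b: "(\<Sum>i=1..d. (b i)\<^sup>2) \<le> 1"
      by (simp add: L2_set_def)
    have "Lp_norm M p (\<lambda>\<omega>. \<Sum>i=1..d. \<xi> i \<omega> * b i) = Lp_norm M p (\<lambda>\<omega>. \<Sum>i=1..d. b i * zero_ext d \<xi> \<omega> i)"
      by (intro Lp_norm_cong sum.cong) (auto simp: zero_ext_def mult.commute)
    also have "\<dots> = Lp_norm ?N p (\<lambda>x. \<Sum>i=1..d. b i * x i)"
      unfolding seq_law_def by (rule Lp_norm_distr[symmetric]) measurable
    also have "\<dots> \<le> (SUP n\<in>{1..}. SUP b\<in>{b :: nat \<Rightarrow> real. (\<Sum>i=1..n. (b i)\<^sup>2) \<le> 1}.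
       Lp_norm ?N p (\<lambda>x. \<Sum>i=1..n. b i * x i))"
      \<comment> \<open>The left-hand supremum is bounded below by its term at \<open>n = d\<close>
        and the given \<open>b\<close>; \<open>d \<ge> 1\<close> makes \<open>d\<close> an
        admissible index.\<close>
      using d b by (intro SUP_upper2[of d] SUP_upper2[of b]) auto
    also have "\<dots> \<le> C * (SUP i\<in>{1..}. Lp_norm ?N p (\<lambda>x. x i))"
      using ineq unfolding norm_inequality_def .
    finally show "Lp_norm M p (\<lambda>\<omega>. \<Sum>i=1..d. \<xi> i \<omega> * b i)
      \<le> C * (SUP i\<in>{1..}. Lp_norm ?N p (\<lambda>x. x i))" .
  qed
  \<comment> \<open>Beyond \<open>d\<close> the coordinates have norm 0, so the supremum over all
    indices is at most the maximum over \<open>{1..d}\<close>.\<close>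
  also have "\<dots> \<le> C * Max ((\<lambda>i. Lp_norm M p (\<xi> i)) ` {1..d})"
    by (intro mult_left_mono SUP_least) (auto simp: Lp_norm_coordinate)
  finally show ?thesis .
qed

end

section \<open>Martingale differences\<close>

text \<open>Conditional expectation is characterised by its integrals over the events of
  \<open>F\<close>. In this form the martingale property can be transported by a change of
  variables.\<close>

lemma (in prob_space) real_cond_exp_eq_0_iff:
  assumes F: "subalgebra M F" and f: "integrable M f"
  shows "(AE \<omega> in M. real_cond_exp M F f \<omega> = 0) \<longleftrightarrow> (\<forall>A\<in>sets F. (LINT \<omega>:A|M. f \<omega>) = 0)"
proof -
  interpret finite_measure_subalgebra M F
    using F by unfold_locales
  show ?thesis
  proof
    assume ae: "AE \<omega> in M. real_cond_exp M F f \<omega> = 0"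
    show "\<forall>A\<in>sets F. (LINT \<omega>:A|M. f \<omega>) = 0"
    proof
      fix A assume A: "A \<in> sets F"
      have "(LINT \<omega>:A|M. f \<omega>) = (LINT \<omega>:A|M. real_cond_exp M F f \<omega>)"
        using f A by (rule real_cond_exp_intA)
      also have "\<dots> = 0"
        unfolding set_lebesgue_integral_def
        by (rule integral_eq_zero_AE) (use ae in eventually_elim, simp)
      finally show "(LINT \<omega>:A|M. f \<omega>) = 0" .
    qed
  next
    assume "\<forall>A\<in>sets F. (LINT \<omega>:A|M. f \<omega>) = 0"
    then show "AE \<omega> in M. real_cond_exp M F f \<omega> = 0"
      by (intro real_cond_exp_charact f) (auto simp: set_lebesgue_integral_def)
  qed
qed

context random_vector
begin

text \<open>
  Level \<open>0\<close> is treated apart: the events with trivial preimage need not be trivial themselves, since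
  the vector is not surjective onto the sequences.
\<close>

definition push_filtration :: "(nat \<Rightarrow> 'a measure) \<Rightarrow> nat \<Rightarrow> (nat \<Rightarrow> real) measure" where
  "push_filtration F k = sigma UNIV (if k = 0 then {{}, UNIV}
     else {A \<in> sets (PiM UNIV (\<lambda>_. borel)). zero_ext d \<xi> -` A \<inter> space M \<in> sets (F k)})"

lemma space_push_filtration [simp]: "space (push_filtration F k) = UNIV"
  by (simp add: push_filtration_def space_measure_of_conv)

text \<open>Preimages commute with complements and countable unions, so the generating family is
  already a \<sigma>-algebra and \<open>sigma\<close> adds no events.\<close>

lemma sets_push_filtration:
  assumes "subalgebra M (F k)"
  shows "sets (push_filtration F k) = (if k = 0 then {{}, UNIV}
     else {A \<in> sets (PiM UNIV (\<lambda>_. borel)). zero_ext d \<xi> -` A \<inter> space M \<in> sets (F k)})"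
proof (cases "k = 0")
  case True
  then show ?thesis
    using sigma_algebra.sets_measure_of_eq[OF sigma_algebra_trivial, of "UNIV :: (nat \<Rightarrow> real) set"]
    by (simp add: push_filtration_def)
next
  case False
  let ?P = "PiM UNIV (\<lambda>_. borel) :: (nat \<Rightarrow> real) measure"
  let ?A = "{A \<in> sets ?P. zero_ext d \<xi> -` A \<inter> space M \<in> sets (F k)}"
  have space: "space M = space (F k)" using assms by (simp add: subalgebra_def)
  have UNIV: "UNIV = space ?P" by (simp add: space_PiM)
  have "sigma_algebra UNIV ?A"
    unfolding sigma_algebra_iff2
  proof (intro conjI ballI allI impI)
    fix A assume A: "A \<in> ?A"
    have "zero_ext d \<xi> -` (UNIV - A) \<inter> space M = space (F k) - (zero_ext d \<xi> -` A \<inter> space M)"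
      using space by auto
    then show "UNIV - A \<in> ?A"
      using A sets.compl_sets[of A ?P] unfolding UNIV[symmetric] by auto
  next
    fix A :: "nat \<Rightarrow> (nat \<Rightarrow> real) set" assume A: "range A \<subseteq> ?A"
    have "zero_ext d \<xi> -` (\<Union> (range A)) \<inter> space M = (\<Union>i. zero_ext d \<xi> -` A i \<inter> space M)" by auto
    also have "\<dots> \<in> sets (F k)" using A by (intro sets.countable_UN) auto
    finally show "\<Union> (range A) \<in> ?A"
      using A by (auto intro!: sets.countable_UN)
  qed auto
  then show ?thesis
    using False by (simp add: push_filtration_def sigma_algebra.sigma_sets_eq)
qed

text \<open>An event of level \<open>k\<close> pulls back to an event of \<open>F k\<close>. Hence
  the coordinates are adapted, and their integrals over pushed events are integrals of the original
  variables over events of \<open>F k\<close>.\<close>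

lemma centered_martingale_differences_seq_law:
  assumes mart: "centered_martingale_differences M F {1..d} \<xi>"
  shows "centered_martingale_differences (seq_law M d \<xi>) (push_filtration F) {1..} (\<lambda>i x. x i)"
proof -
  let ?N = "seq_law M d \<xi>" and ?G = "push_filtration F" and ?X = "zero_ext d \<xi>"
  interpret N: prob_space ?N by (rule prob_space_seq_law)
  have subF: "subalgebra M (F k)"
    and monoF: "i \<le> j \<Longrightarrow> sets (F i) \<subseteq> sets (F j)"
    and F0: "sets (F 0) = {{}, space M}" for k i j
    using mart by (auto simp: centered_martingale_differences_def filtration_def)
  have spaceF: "space (F k) = space M" for k using subF by (auto simp: subalgebra_def)
  note sets_G = sets_push_filtration[of F, OF subF]
  have UNIV: "UNIV \<in> sets (PiM UNIV (\<lambda>_. borel) :: (nat \<Rightarrow> real) measure)"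
    using sets.top[of "PiM UNIV (\<lambda>_. borel) :: (nat \<Rightarrow> real) measure"] by (simp add: space_PiM)
  \<comment> \<open>Level 0 is covered too: the preimages of \<open>{}\<close> and
    \<open>UNIV\<close> are \<open>{}\<close> and \<open>space M\<close>.\<close>
  have preimage: "A \<in> sets (PiM UNIV (\<lambda>_. borel)) \<and> ?X -` A \<inter> space M \<in> sets (F k)"
    if "A \<in> sets (?G k)" for A k
    using that UNIV sets.top[of "F k"] unfolding sets_G spaceF by (auto split: if_splits)
  have subG: "subalgebra ?N (?G k)" for k
    using preimage by (auto simp: subalgebra_def)
  have sets_G0: "sets (?G 0) = {{}, UNIV}" by (simp add: sets_G)
  have "filtration UNIV ?G"
  proof
    fix i j :: nat assume ij: "i \<le> j"
    show "sets (?G i) \<subseteq> sets (?G j)"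
    proof (cases "i = 0")
      case True
      then show ?thesis using sets_G0 sets.top[of "?G j"] by auto
    next
      case False
      then show ?thesis using monoF[OF ij] ij by (auto simp: sets_G)
    qed
  qed simp
  moreover have "integrable ?N (\<lambda>x. x i) \<and> (\<lambda>x. x i) \<in> borel_measurable (?G i) \<and>
      (\<forall>k<i. AE x in ?N. real_cond_exp ?N (?G k) (\<lambda>x. x i) x = 0)" if "i \<ge> 1" for i
  proof -
    \<comment> \<open>For \<open>i\<close> in \<open>{1..d}\<close> these facts come from
      \<open>mart\<close>; beyond \<open>d\<close> the coordinate is the constant 0.\<close>
    have int_X: "integrable M (\<lambda>\<omega>. ?X \<omega> i)"
      and meas_X: "(\<lambda>\<omega>. ?X \<omega> i) \<in> borel_measurable (F i)"
      and zero_X: "\<And>k A. k < i \<Longrightarrow> A \<in> sets (F k) \<Longrightarrow> (LINT \<omega>:A|M. ?X \<omega> i) = 0"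
    proof (atomize (full), cases "i \<in> {1..d}")
      case True
      then have \<xi>: "integrable M (\<xi> i)" "\<xi> i \<in> borel_measurable (F i)"
        "\<forall>k<i. AE \<omega> in M. real_cond_exp M (F k) (\<xi> i) \<omega> = 0"
        using mart by (auto simp: centered_martingale_differences_def)
      moreover have "\<forall>k<i. \<forall>A\<in>sets (F k). (LINT \<omega>:A|M. \<xi> i \<omega>) = 0"
        using \<xi>(3) by (simp add: real_cond_exp_eq_0_iff[OF subF \<xi>(1)])
      ultimately show "integrable M (\<lambda>\<omega>. ?X \<omega> i) \<and> (\<lambda>\<omega>. ?X \<omega> i) \<in> borel_measurable (F i) \<and>
          (\<forall>k A. k < i \<longrightarrow> A \<in> sets (F k) \<longrightarrow> (LINT \<omega>:A|M. ?X \<omega> i) = 0)"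
        using True by (simp add: zero_ext_coordinate)
    qed (simp add: zero_ext_coordinate set_lebesgue_integral_def del: atLeastAtMost_iff)
    have int: "integrable ?N (\<lambda>x. x i)"
      using int_X unfolding seq_law_def by (subst integrable_distr_eq) auto
    have "(\<lambda>x. x i) \<in> borel_measurable (?G i)"
    proof (rule measurableI)
      fix B :: "real set" assume B: "B \<in> sets borel"
      have "(\<lambda>x. x i) -` B \<inter> space (PiM UNIV (\<lambda>_. borel)) \<in> sets (PiM UNIV (\<lambda>_. borel) :: (nat \<Rightarrow> real) measure)"
        using B by measurable
      moreover have "?X -` ((\<lambda>x. x i) -` B) \<inter> space M = (\<lambda>\<omega>. ?X \<omega> i) -` B \<inter> space (F i)"
        by (auto simp: spaceF)
      \<comment> \<open>As \<open>i \<ge> 1\<close>, membership in level \<open>i\<close> is decided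
        by the preimage, and that is an event of \<open>F i\<close> by adaptedness.\<close>
      ultimately show "(\<lambda>x. x i) -` B \<inter> space (?G i) \<in> sets (?G i)"
        using that measurable_sets[OF meas_X B] by (simp add: sets_G space_PiM)
    qed simp
    moreover have "AE x in ?N. real_cond_exp ?N (?G k) (\<lambda>x. x i) x = 0" if "k < i" for k
      unfolding N.real_cond_exp_eq_0_iff[OF subG int]
    proof
      fix A assume A: "A \<in> sets (?G k)"
      have [measurable]: "A \<in> sets (PiM UNIV (\<lambda>_. borel))" using preimage[OF A] by simp
      \<comment> \<open>Change of variables along \<open>zero_ext d \<xi>\<close> turns this into an
        integral over the preimage of \<open>A\<close>, which lies in \<open>F k\<close>.\<close>
      have "(LINT x:A|?N. x i) = (LINT \<omega>|M. indicator A (?X \<omega>) *\<^sub>R ?X \<omega> i)"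
        unfolding set_lebesgue_integral_def seq_law_def by (rule integral_distr) measurable
      also have "\<dots> = (LINT \<omega>:?X -` A \<inter> space M|M. ?X \<omega> i)"
        unfolding set_lebesgue_integral_def
        by (rule Bochner_Integration.integral_cong) (auto simp: indicator_def)
      also have "\<dots> = 0" using zero_X[OF that] preimage[OF A] by blast
      finally show "(LINT x:A|?N. x i) = 0" .
    qed
    ultimately show ?thesis using int by blast
  qed
  ultimately show ?thesis
    using subG sets_G0 by (auto simp: centered_martingale_differences_def)
qed

end

text \<open>The filtration is trivial at 0 and equal to \<open>M\<close> from 1 on. It will be
  applied to a fair coin.\<close>

lemma (in prob_space) centered_martingale_differences_singleton:
  assumes f: "integrable M f" "integral\<^sup>L M f = 0"
  shows "\<exists>F. centered_martingale_differences M F {1..1} (\<lambda>_. f)"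
proof -
  define F where "F k = (if k = 0 then sigma (space M) {{}, space M} else M)" for k :: nat
  have sets0: "sets (F 0) = {{}, space M}"
    by (simp add: F_def sigma_algebra.sets_measure_of_eq[OF sigma_algebra_trivial])
  have space_F: "space (F k) = space M" for k by (simp add: F_def space_measure_of_conv)
  have sub: "subalgebra M (F k)" for k
    using sets0 by (cases "k = 0") (auto simp: subalgebra_def space_F, auto simp: F_def)
  have "filtration (space M) F"
  proof
    fix i j :: nat assume "i \<le> j"
    then show "sets (F i) \<subseteq> sets (F j)"
      using sub[of i] by (cases "j = 0") (auto simp: F_def subalgebra_def)
  qed (rule space_F)
  \<comment> \<open>Level 0 is the only one below index 1; over its two events the integral of
    \<open>f\<close> is 0 and the mean of \<open>f\<close>.\<close>
  moreover have "AE \<omega> in M. real_cond_exp M (F 0) f \<omega> = 0"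
    using f by (auto simp: real_cond_exp_eq_0_iff[OF sub] sets0 set_lebesgue_integral_def
        cong: Bochner_Integration.integral_cong)
  ultimately have "centered_martingale_differences M F {1..1} (\<lambda>_. f)"
    using sub sets0 f by (auto simp: centered_martingale_differences_def F_def)
  then show ?thesis by (rule exI[of _ F])
qed

section \<open>Independent variables\<close>

context random_vector
begin

text \<open>Appended coordinates are constant, so their events pull back to the empty set or the
  whole space. The product rule for finite subfamilies therefore reduces to indices in
  \<open>{1..d}\<close>.\<close>

lemma centered_independent_seq_law:
  assumes ind: "centered_independent M {1..d} \<xi>"
  shows "centered_independent (seq_law M d \<xi>) {1..} (\<lambda>i x. x i)"
proof -
  let ?N = "seq_law M d \<xi>" and ?X = "zero_ext d \<xi>"
  interpret N: prob_space ?N by (rule prob_space_seq_law)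
  have indep: "indep_sets (\<lambda>i. {\<xi> i -` A \<inter> space M |A. A \<in> sets borel}) {1..d}"
    using ind by (simp add: centered_independent_def indep_vars_def2)
  have coord: "(\<lambda>x. x i) -` B \<in> sets (PiM UNIV (\<lambda>_. borel) :: (nat \<Rightarrow> real) measure)"
    if "B \<in> sets borel" for i and B :: "real set"
    using measurable_sets[OF measurable_coordinate that] by (simp add: space_PiM)
  have "N.indep_sets (\<lambda>i. {(\<lambda>x. x i) -` A \<inter> space ?N |A. A \<in> sets borel}) {1..}"
  proof (rule N.indep_setsI)
    fix A and J :: "nat set"
    assume J: "J \<noteq> {}" "J \<subseteq> {1..}" "finite J"
      and "\<forall>j\<in>J. A j \<in> {(\<lambda>x. x j) -` A \<inter> space ?N |A. A \<in> sets borel}"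
    then have "\<forall>j\<in>J. \<exists>B. B \<in> sets borel \<and> A j = (\<lambda>x. x j) -` B" by auto
    then obtain B where B: "\<And>j. j \<in> J \<Longrightarrow> B j \<in> sets (borel :: real measure)"
      and A: "\<And>j. j \<in> J \<Longrightarrow> A j = (\<lambda>x. x j) -` B j"
      by metis
    define E where "E j = ?X -` A j \<inter> space M" for j
    have sets_A: "A j \<in> sets (PiM UNIV (\<lambda>_. borel))" if "j \<in> J" for j
      using coord[OF B[OF that]] A[OF that] by simp
    have prob_A: "measure ?N (A j) = prob (E j)" if "j \<in> J" for j
      using measure_seq_law[OF sets_A[OF that]] by (simp add: E_def)
    have E_in: "E j = \<xi> j -` B j \<inter> space M" if "j \<in> J" "j \<in> {1..d}" for j
      using that A[of j] by (auto simp: E_def zero_ext_def)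
    have E_out: "E j = (if 0 \<in> B j then space M else {})" if "j \<in> J" "j \<notin> {1..d}" for j
      using that A[of j] by (auto simp: E_def zero_ext_def)
    have "measure ?N (\<Inter>j\<in>J. A j) = prob (?X -` (\<Inter>j\<in>J. A j) \<inter> space M)"
      using J sets_A by (intro measure_seq_law sets.finite_INT) auto
    also have "?X -` (\<Inter>j\<in>J. A j) \<inter> space M = (\<Inter>j\<in>J. E j)"
      using J by (auto simp: E_def)
    also have "prob (\<Inter>j\<in>J. E j) = (\<Prod>j\<in>J. prob (E j))"
    proof (cases "\<exists>j\<in>J. E j = {}")
      case True
      then have "(\<Inter>j\<in>J. E j) = {}" and "(\<Prod>j\<in>J. prob (E j)) = 0"
        using J by (blast, metis measure_empty prod_zero)
      then show ?thesis by simp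
    next
      case False
      let ?K = "J \<inter> {1..d}"
      have full: "E j = space M" if "j \<in> J - ?K" for j
        using that E_out[of j] False by (auto split: if_splits)
      have "(\<Prod>j\<in>J. prob (E j)) = (\<Prod>j\<in>?K. prob (E j))"
        using J full by (intro prod.mono_neutral_right) (auto simp: prob_space)
      \<comment> \<open>Independence yields the product rule for nonempty index sets; for empty
        \<open>?K\<close> all events are certain and the empty product is 1.\<close>
      also have "\<dots> = prob (\<Inter>j\<in>J. E j)"
      proof (cases "?K = {}")
        case True
        then have "(\<Inter>j\<in>J. E j) = space M" using J(1) full by auto
        then show ?thesis by (simp only: True prod.empty prob_space)
      next
        case K: False
        have "(\<Inter>j\<in>J. E j) = (\<Inter>j\<in>?K. E j)"
        proof
          show "(\<Inter>j\<in>?K. E j) \<subseteq> (\<Inter>j\<in>J. E j)"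
          proof
            fix \<omega> assume \<omega>: "\<omega> \<in> (\<Inter>j\<in>?K. E j)"
            \<comment> \<open>Nonemptiness of \<open>?K\<close> enters here: an intersection over no
              indices would be \<open>UNIV\<close> and not \<open>space M\<close>.\<close>
            then have "\<omega> \<in> space M" using K by (auto simp: E_def)
            then show "\<omega> \<in> (\<Inter>j\<in>J. E j)" using \<omega> full by blast
          qed
        qed auto
        moreover have "prob (\<Inter>j\<in>?K. E j) = (\<Prod>j\<in>?K. prob (E j))"
          using J K B E_in by (intro indep_setsD[OF indep]) auto
        ultimately show ?thesis by simp
      qed
      finally show ?thesis ..
    qed
    also have "\<dots> = (\<Prod>j\<in>J. measure ?N (A j))"
      using prob_A by simp
    finally show "measure ?N (\<Inter>j\<in>J. A j) = (\<Prod>j\<in>J. measure ?N (A j))" .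
  qed (auto simp: coord)
  moreover have "(\<lambda>x. x i) \<in> borel_measurable ?N" for i
    by measurable
  ultimately have "N.indep_vars (\<lambda>_. borel) (\<lambda>i x. x i) {1..}"
    by (simp add: N.indep_vars_def2)
  moreover have "integrable ?N (\<lambda>x. x i) \<and> integral\<^sup>L ?N (\<lambda>x. x i) = 0" for i
  proof -
    have "integrable M (\<lambda>\<omega>. ?X \<omega> i)" "integral\<^sup>L M (\<lambda>\<omega>. ?X \<omega> i) = 0"
      using ind by (auto simp: centered_independent_def zero_ext_coordinate)
    then show ?thesis
      unfolding seq_law_def by (auto simp: integrable_distr_eq integral_distr)
  qed
  ultimately show ?thesis by (simp add: centered_independent_def)
qed

end

text \<open>The only nonempty subfamily is \<open>{1}\<close>, for which the product rule is
  trivial.\<close>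

lemma (in prob_space) centered_independent_singleton:
  assumes f: "integrable M f" "integral\<^sup>L M f = 0"
  shows "centered_independent M {1..1} (\<lambda>_. f)"
proof -
  have [measurable]: "f \<in> borel_measurable M" using f by auto
  have "indep_vars (\<lambda>_. borel) (\<lambda>_. f) {1..1::nat}"
    unfolding indep_vars_def2
  proof (intro conjI indep_setsI)
    fix A and J :: "nat set" assume "J \<noteq> {}" "J \<subseteq> {1..1}"
    then have "J = {1}" by auto
    then show "prob (\<Inter>j\<in>J. A j) = (\<Prod>j\<in>J. prob (A j))" by simp
  qed auto
  then show ?thesis using f by (auto simp: centered_independent_def)
qed

section \<open>The optimal constants\<close>

definition coin :: "bool \<Rightarrow> real" where
  "coin b = (if b then 1 else - 1)"

lemma integrable_coin: "integrable (measure_pmf (bernoulli_pmf (1 / 2))) coin"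
  by (intro integrable_measure_pmf_finite) auto

lemma integral_coin: "integral\<^sup>L (measure_pmf (bernoulli_pmf (1 / 2))) coin = 0"
  by (subst integral_measure_pmf[of UNIV]) (auto simp: coin_def UNIV_bool)

text \<open>The coin has absolute value 1 everywhere, hence norm 1, and the assumed bound becomes
  \<open>1 \<le> C * 1\<close> after bounding its left-hand side below.\<close>

lemma one_le_of_coin:
  assumes "Lpd_norm (measure_pmf (bernoulli_pmf (1 / 2))) p 1 (\<lambda>_. coin)
      \<le> C * Max ((\<lambda>i. Lp_norm (measure_pmf (bernoulli_pmf (1 / 2))) p coin) ` {1..1::nat})"
  shows "1 \<le> C"
proof -
  have "Lp_norm (measure_pmf (bernoulli_pmf (1 / 2))) p coin = 1"
    by (rule prob_space.Lp_norm_abs_1) (auto simp: coin_def prob_space_measure_pmf)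
  then show ?thesis
    using assms Lp_norm_le_Lpd_norm_1[of "measure_pmf (bernoulli_pmf (1 / 2))" p "\<lambda>_. coin"]
    by simp
qed

text \<open>The law of \<open>\<xi>\<close> is one of the spaces over which \<open>C\<close> is
  admissible. The sample space is arbitrary, so that the same bound serves the given vector and the
  coin.\<close>

lemma Lpd_norm_le_martingale:
  assumes C: "\<forall>(N :: (nat \<Rightarrow> real) measure) G \<theta>. prob_space N \<longrightarrow>
      centered_martingale_differences N G {1..} \<theta> \<longrightarrow> norm_inequality N p \<theta> C"
    and "prob_space M" "d \<ge> 1" "\<exists>F. centered_martingale_differences M F {1..d} \<xi>"
  shows "Lpd_norm M p d \<xi> \<le> C * Max ((\<lambda>i. Lp_norm M p (\<xi> i)) ` {1..d})"
proof -
  obtain F where F: "centered_martingale_differences M F {1..d} \<xi>"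
    using assms(4) by blast
  interpret prob_space M by fact
  interpret random_vector M d \<xi>
    by unfold_locales (use F in \<open>auto simp: centered_martingale_differences_def\<close>)
  show ?thesis
    using C prob_space_seq_law centered_martingale_differences_seq_law[OF F] \<open>d \<ge> 1\<close>
    by (intro Lpd_norm_le_of_norm_inequality) blast+
qed

lemma Lpd_norm_le_independent:
  assumes C: "\<forall>(N :: (nat \<Rightarrow> real) measure) \<theta>. prob_space N \<longrightarrow>
      centered_independent N {1..} \<theta> \<longrightarrow> norm_inequality N p \<theta> C"
    and "prob_space M" "d \<ge> 1" and ind: "centered_independent M {1..d} \<xi>"
  shows "Lpd_norm M p d \<xi> \<le> C * Max ((\<lambda>i. Lp_norm M p (\<xi> i)) ` {1..d})"
proof -
  interpret prob_space M by fact
  interpret random_vector M d \<xi>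
    by unfold_locales (use ind in \<open>auto simp: centered_independent_def\<close>)
  show ?thesis
    using C prob_space_seq_law centered_independent_seq_law[OF ind] \<open>d \<ge> 1\<close>
    by (intro Lpd_norm_le_of_norm_inequality) blast+
qed

theorem proposition5p1:
  fixes M :: "'a measure" and \<xi> :: "nat \<Rightarrow> 'a \<Rightarrow> real" and p :: real and d :: nat
  assumes "prob_space M"
    and "p \<ge> 2"
    and "d \<ge> 1"
    and "\<forall>i\<in>{1..d}. \<xi> i \<in> borel_measurable M"
  shows "((\<exists>F. centered_martingale_differences M F {1..d} \<xi>) \<longrightarrow>
            Lpd_norm M p d \<xi> \<le> K_M p * Max ((\<lambda>i. Lp_norm M p (\<xi> i)) ` {1..d})) \<and>
         (centered_independent M {1..d} \<xi> \<longrightarrow>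
            Lpd_norm M p d \<xi> \<le> K_I p * Max ((\<lambda>i. Lp_norm M p (\<xi> i)) ` {1..d}))"
proof -
  \<comment> \<open>Each coordinate norm lies between 0 and the maximum, so a zero maximum makes all
    of them vanish.\<close>
  have zero: "Lpd_norm M p d \<xi> = 0" if "Max ((\<lambda>i. Lp_norm M p (\<xi> i)) ` {1..d}) = 0"
  proof (rule Lpd_norm_eq_0)
    fix i assume "i \<in> {1..d}"
    then have "Lp_norm M p (\<xi> i) \<le> Max ((\<lambda>i. Lp_norm M p (\<xi> i)) ` {1..d})" by simp
    then show "Lp_norm M p (\<xi> i) = 0" using that by simp
  qed (use assms(4) in blast)
  have A: "Lpd_norm M p d \<xi> \<le> K_M p * Max ((\<lambda>i. Lp_norm M p (\<xi> i)) ` {1..d})"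
    if mart: "\<exists>F. centered_martingale_differences M F {1..d} \<xi>"
    unfolding K_M_def
  proof (rule le_Inf_mult_ennreal)
    fix C assume "C \<in> {C. \<forall>(N :: (nat \<Rightarrow> real) measure) G \<theta>. prob_space N \<longrightarrow>
      centered_martingale_differences N G {1..} \<theta> \<longrightarrow> norm_inequality N p \<theta> C}"
    note C = this[unfolded mem_Collect_eq]
    show "Lpd_norm M p d \<xi> \<le> C * Max ((\<lambda>i. Lp_norm M p (\<xi> i)) ` {1..d})"
      by (rule Lpd_norm_le_martingale[OF C assms(1,3) mart])
    \<comment> \<open>Admissibility of \<open>C\<close> is tested on the fair coin as a
      one-dimensional martingale difference.\<close>
    show "1 \<le> C"
      by (rule one_le_of_coin, rule Lpd_norm_le_martingale[OF C prob_space_measure_pmf order_refl])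
        (rule prob_space.centered_martingale_differences_singleton[OF prob_space_measure_pmf integrable_coin integral_coin])
  qed (rule zero)
  have B: "Lpd_norm M p d \<xi> \<le> K_I p * Max ((\<lambda>i. Lp_norm M p (\<xi> i)) ` {1..d})"
    if ind: "centered_independent M {1..d} \<xi>"
    unfolding K_I_def
  proof (rule le_Inf_mult_ennreal)
    fix C assume "C \<in> {C. \<forall>(N :: (nat \<Rightarrow> real) measure) \<theta>. prob_space N \<longrightarrow>
      centered_independent N {1..} \<theta> \<longrightarrow> norm_inequality N p \<theta> C}"
    note C = this[unfolded mem_Collect_eq]
    show "Lpd_norm M p d \<xi> \<le> C * Max ((\<lambda>i. Lp_norm M p (\<xi> i)) ` {1..d})"
      by (rule Lpd_norm_le_independent[OF C assms(1,3) ind])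
    \<comment> \<open>The same coin, now as a one-element independent family.\<close>
    show "1 \<le> C"
      by (rule one_le_of_coin, rule Lpd_norm_le_independent[OF C prob_space_measure_pmf order_refl])
        (rule prob_space.centered_independent_singleton[OF prob_space_measure_pmf integrable_coin integral_coin])
  qed (rule zero)
  show ?thesis using A B by (intro conjI impI)
qed

end
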